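(* Let $A,B\in\mathrm{PU}(2,1)$ be two parabolic isometries such that $AB$ (and thus $BA$) is parabolic, with fixed points $p_A,p_B,p_{AB},p_{BA}\in\partial\mathbf{H}^2_{\mathbb{C}}$ of $A,B,AB,BA$ respectively, assumed pairwise distinct. Then: 1. The cross-ratio $\mathbb{X}(p_A,p_B,p_{AB},p_{BA})$ has unit modulus. 2. Moreover, setting $C=(AB)^{-1}$ and denoting by $\lambda_C$ the eigenvalue of $C$ associated with $p_{AB}$, and by $\lambda_A,\lambda_B$ the eigenvalues of $A,B$ associated with $p_A,p_B$, one has $$\mathbb{X}(p_A,p_B,p_{AB},p_{BA})=\lambda_A\lambda_B\lambda_C .$$
   Context: $\langle\cdot,\cdot\rangle$ is a Hermitian form of signature $(2,1)$ on $\mathbb{C}^3$, linear in the first variable. $\mathbf{H}^2_{\mathbb{C}}$ (resp. $\partial\mathbf{H}^2_{\mathbb{C}}$) is the set of complex lines spanned by negative (resp. non-zero null) vectors; a lift of a point $p$ is a non-zero vector $\mathbf{p}$ spanning it. $\mathrm{PU}(2,1)$ is the holomorphic isometry group of $\mathbf{H}^2_{\mathbb{C}}$. A parabolic isometry is one with exactly one fixed point in $\mathbf{H}^2_{\mathbb{C}}\cup\partial\mathbf{H}^2_{\mathbb{C}}$, lying on $\partial\mathbf{H}^2_{\mathbb{C}}$. Eigenvalues are those of lifts to $\mathrm{SU}(2,1)$: fix lifts of $A$ and $B$ to $\mathrm{SU}(2,1)$, and let the lifts of $AB$ and $C$ be the corresponding product and its inverse; the eigenvalue of $T$ associated with a fixed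 point $p$ is the $\lambda$ with $T\mathbf{p}=\lambda\mathbf{p}$. The cross-ratio is $$\mathbb{X}(p_1,p_2,p_3,p_4)=\frac{\langle\mathbf{p}_3,\mathbf{p}_1\rangle\langle\mathbf{p}_4,\mathbf{p}_2\rangle}{\langle\mathbf{p}_3,\mathbf{p}_2\rangle\langle\mathbf{p}_4,\mathbf{p}_1\rangle}.$$ *)

theory Defs
  imports "HOL-Analysis.Analysis"
begin

text \<open>Hermitian forms on complex 3-space, linear in the first variable.\<close>

definition hermitian_form :: "(complex^3 \<Rightarrow> complex^3 \<Rightarrow> complex) \<Rightarrow> bool" where
  "hermitian_form h \<longleftrightarrow>
     (\<forall>x y z. h (x + y) z = h x z + h y z) \<and>
     (\<forall>c x z. h (c *s x) z = c * h x z) \<and>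
     (\<forall>x y. h y x = cnj (h x y))"

text \<open>Three spanning vectors of complex 3-space form a basis, so this asks for a basis in which
  the form is diagonal with entries 1, 1, -1.\<close>

definition signature_2_1 :: "(complex^3 \<Rightarrow> complex^3 \<Rightarrow> complex) \<Rightarrow> bool" where
  "signature_2_1 h \<longleftrightarrow>
     (\<exists>a b c. vec.span {a, b, c} = UNIV \<and>
        h a b = 0 \<and> h a c = 0 \<and> h b c = 0 \<and>
        h a a = 1 \<and> h b b = 1 \<and> h c c = -1)"

text \<open>Points are complex lines through the origin, represented by the corresponding
  one-dimensional complex subspaces.\<close>

type_synonym cline = "(complex^3) set"

definition is_lift :: "complex^3 \<Rightarrow> cline \<Rightarrow> bool" where
  "is_lift v p \<longleftrightarrow> v \<noteq> 0 \<and> p = vec.span {v}"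

text \<open>The values \<open>h v v\<close> of a Hermitian form are real, whence the real part below.\<close>

definition H2 :: "(complex^3 \<Rightarrow> complex^3 \<Rightarrow> complex) \<Rightarrow> cline set" where
  "H2 h = {p. \<exists>v. is_lift v p \<and> Re (h v v) < 0}"

definition bd_H2 :: "(complex^3 \<Rightarrow> complex^3 \<Rightarrow> complex) \<Rightarrow> cline set" where
  "bd_H2 h = {p. \<exists>v. is_lift v p \<and> h v v = 0}"

definition closed_H2 :: "(complex^3 \<Rightarrow> complex^3 \<Rightarrow> complex) \<Rightarrow> cline set" where
  "closed_H2 h = H2 h \<union> bd_H2 h"

definition U21 :: "(complex^3 \<Rightarrow> complex^3 \<Rightarrow> complex) \<Rightarrow> (complex^3^3) set" where
  "U21 h = {M. \<forall>x y. h (M *v x) (M *v y) = h x y}"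

definition SU21 :: "(complex^3 \<Rightarrow> complex^3 \<Rightarrow> complex) \<Rightarrow> (complex^3^3) set" where
  "SU21 h = {M \<in> U21 h. det M = 1}"

text \<open>The transformation of the closed complex hyperbolic plane induced by a matrix. It is
  undefined off \<open>closed_H2 h\<close>, so that scalar multiples of a matrix preserving \<open>h\<close> induce
  the same function and elements of PU(2,1) can be represented by the induced functions.\<close>

definition proj_map :: "(complex^3 \<Rightarrow> complex^3 \<Rightarrow> complex) \<Rightarrow> complex^3^3 \<Rightarrow> cline \<Rightarrow> cline" where
  "proj_map h M = restrict (\<lambda>p. (*v) M ` p) (closed_H2 h)"

text \<open>The holomorphic isometries of the complex hyperbolic plane, extended to its boundary:
  the projectivization of the unitary group of the form. The group product of \<open>S\<close> and \<open>T\<close> is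
  \<open>compose (closed_H2 h) S T\<close>.\<close>

definition PU21 :: "(complex^3 \<Rightarrow> complex^3 \<Rightarrow> complex) \<Rightarrow> (cline \<Rightarrow> cline) set" where
  "PU21 h = proj_map h ` U21 h"

definition parabolic ::
  "(complex^3 \<Rightarrow> complex^3 \<Rightarrow> complex) \<Rightarrow> (cline \<Rightarrow> cline) \<Rightarrow> bool" where
  "parabolic h T \<longleftrightarrow> (\<exists>q \<in> bd_H2 h. {p \<in> closed_H2 h. T p = p} = {q})"

definition is_SU_lift ::
  "(complex^3 \<Rightarrow> complex^3 \<Rightarrow> complex) \<Rightarrow> complex^3^3 \<Rightarrow> (cline \<Rightarrow> cline) \<Rightarrow> bool" where
  "is_SU_lift h M T \<longleftrightarrow> M \<in> SU21 h \<and> proj_map h M = T"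

text \<open>Meaningful when the matrix maps the line \<open>p\<close> to itself; see \<open>eigenvalue_at_eq\<close>.\<close>

definition eigenvalue_at :: "complex^3^3 \<Rightarrow> cline \<Rightarrow> complex" where
  "eigenvalue_at M p = (THE l. \<forall>v. is_lift v p \<longrightarrow> M *v v = l *s v)"

text \<open>Some lift of each point is chosen; \<open>cross_ratio_eq\<close> shows that the choice is immaterial.\<close>

definition cross_ratio ::
  "(complex^3 \<Rightarrow> complex^3 \<Rightarrow> complex) \<Rightarrow> cline \<Rightarrow> cline \<Rightarrow> cline \<Rightarrow> cline \<Rightarrow> complex" where
  "cross_ratio h p1 p2 p3 p4 =
     (let v1 = (SOME v. is_lift v p1); v2 = (SOME v. is_lift v p2);
          v3 = (SOME v. is_lift v p3); v4 = (SOME v. is_lift v p4)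
      in (h v3 v1 * h v4 v2) / (h v3 v2 * h v4 v1))"

lemma is_lift_scale:
  assumes "is_lift v p" "is_lift w p"
  obtains c where "c \<noteq> 0" "w = c *s v"
proof -
  have "w \<in> vec.span {v}"
    using assms vec.span_base[of w "{w}"] by (auto simp: is_lift_def)
  then obtain c where c: "w = c *s v"
    by (auto simp: vec.span_singleton)
  moreover have "c \<noteq> 0"
    using c assms(2) by (auto simp: is_lift_def)
  ultimately show thesis
    using that by blast
qed

lemma eigenvalue_at_eq:
  assumes "is_lift v p" "M *v v = l *s v"
  shows "eigenvalue_at M p = l"
  unfolding eigenvalue_at_def
proof (rule the_equality)
  show "\<forall>w. is_lift w p \<longrightarrow> M *v w = l *s w"
  proof (intro allI impI)
    fix w assume "is_lift w p"
    then obtain c where w: "w = c *s v"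
      using assms(1) is_lift_scale by blast
    have "M *v w = c *s (l *s v)"
      unfolding w vector_scalar_commute assms(2) ..
    also have "\<dots> = l *s w"
      unfolding w vector_smult_assoc mult.commute[of c l] ..
    finally show "M *v w = l *s w" .
  qed
next
  fix k assume "\<forall>w. is_lift w p \<longrightarrow> M *v w = k *s w"
  then have "k *s v = l *s v"
    using assms by metis
  then show "k = l"
    using assms(1) by (auto simp: is_lift_def)
qed

lemma cross_ratio_eq:
  assumes h: "hermitian_form h"
    and "is_lift v1 p1" "is_lift v2 p2" "is_lift v3 p3" "is_lift v4 p4"
  shows "cross_ratio h p1 p2 p3 p4 = (h v3 v1 * h v4 v2) / (h v3 v2 * h v4 v1)"
proof -
  have sc1: "h (c *s x) y = c * h x y" for c x y
    using h unfolding hermitian_form_def by blast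
  have sym: "h y x = cnj (h x y)" for x y
    using h unfolding hermitian_form_def by blast
  have sc2: "h x (c *s y) = cnj c * h x y" for c x y
    unfolding sym[of x] sc1 complex_cnj_mult ..
  have ch: "\<exists>c. c \<noteq> 0 \<and> (SOME v. is_lift v p) = c *s v" if "is_lift v p" for v p
    using is_lift_scale[OF that someI[of "\<lambda>v. is_lift v p", OF that]] by metis
  obtain c1 c2 c3 c4 where c: "c1 \<noteq> 0" "c2 \<noteq> 0" "c3 \<noteq> 0" "c4 \<noteq> 0"
    and e: "(SOME v. is_lift v p1) = c1 *s v1" "(SOME v. is_lift v p2) = c2 *s v2"
      "(SOME v. is_lift v p3) = c3 *s v3" "(SOME v. is_lift v p4) = c4 *s v4"
    using ch assms(2-5) by meson
  show ?thesis
    unfolding cross_ratio_def Let_def e sc1 sc2 using c by (simp add: field_simps)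
qed

end

theory Submission
  imports Defs
begin

text \<open>
  Choose matrices \<open>M\<close>, \<open>N\<close> preserving the form and inducing \<open>A\<close>, \<open>B\<close>. Since
  \<open>A(BA) = (AB)A\<close> and \<open>AB\<close> has a single fixed point, \<open>A\<close> sends the fixed point of \<open>BA\<close> to that of
  \<open>AB\<close>, and \<open>B\<close> sends it back. In lifts \<open>d\<close>, \<open>c\<close> of these two points, \<open>M d = k c\<close> and
  \<open>N c = (\<mu> / k) d\<close>, where \<open>\<mu>\<close> is the eigenvalue of \<open>M N\<close> at \<open>c\<close>.
  Let \<open>a\<close>, \<open>b\<close> be eigenvectors of \<open>M\<close>, \<open>N\<close> at the fixed points of \<open>A\<close>, \<open>B\<close>, with eigenvalues
  \<open>\<alpha>\<close>, \<open>\<beta>\<close>. Invariance of the form under \<open>M\<close> turns \<open>h d a\<close> into a multiple of \<open>h c a\<close>, and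
  invariance under \<open>N\<close> turns \<open>h c b\<close> into a multiple of \<open>h d b\<close>; dividing, the scalar \<open>k\<close>
  cancels and the cross-ratio becomes \<open>1 / (cnj \<alpha> * cnj \<beta> * \<mu>)\<close>
  (\<open>cross_ratio_of_swapped_points\<close>).

  Both claims then rest on a single fact: the eigenvalue of a parabolic map at its fixed point
  has modulus one (\<open>parabolic_eigenvalue_unimodular\<close>), so that \<open>1 / cnj \<alpha> = \<alpha>\<close> and
  \<open>1 / cnj \<beta> = \<beta>\<close>. Otherwise the eigenvalue \<open>1 / cnj \<alpha>\<close>, which every matrix preserving the form
  has along with \<open>\<alpha>\<close>, would belong to a second fixed point on the boundary. The divisions are
  legitimate because distinct boundary points have non-orthogonal lifts
  (\<open>distinct_boundary_points_not_orthogonal\<close>).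
\<close>

section \<open>Hermitian forms of signature (2,1)\<close>

lemma hermitian_form_left:
  assumes "hermitian_form h"
  shows "h (x + y) z = h x z + h y z" "h (c *s x) z = c * h x z"
    "h (x - y) z = h x z - h y z" "h 0 z = 0"
proof -
  have add: "h (x + y) z = h x z + h y z" and scale: "h (c *s x) z = c * h x z" for c x y z
    using assms unfolding hermitian_form_def by blast+
  show "h (x + y) z = h x z + h y z" "h (c *s x) z = c * h x z"
    by (fact add, fact scale)
  show "h (x - y) z = h x z - h y z"
    using add[of "x - y" y z] by simp
  show "h 0 z = 0"
    using add[of 0 0 z] by simp
qed

lemma hermitian_form_cnj:
  assumes "hermitian_form h"
  shows "h y x = cnj (h x y)"
  using assms unfolding hermitian_form_def by blast

lemma hermitian_form_right:
  assumes "hermitian_form h"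
  shows "h z (x + y) = h z x + h z y" "h z (c *s x) = cnj c * h z x"
    "h z (x - y) = h z x - h z y" "h z 0 = 0"
  unfolding hermitian_form_cnj[OF assms, of z] hermitian_form_left[OF assms] by simp_all

text \<open>
  The signature enters only through this consequence: the orthogonal complement of some negative
  vector is positive definite, so it contains no non-zero null vector.
\<close>

lemma null_free_hyperplane:
  assumes h: "hermitian_form h" and "signature_2_1 h"
  obtains e where "\<And>x. h x x = 0 \<Longrightarrow> h x e = 0 \<Longrightarrow> x = 0"
proof -
  obtain a b e where span: "vec.span {a, b, e} = UNIV"
    and orth: "h a b = 0" "h a e = 0" "h b e = 0"
    and norm: "h a a = 1" "h b b = 1" "h e e = -1"
    using assms(2) unfolding signature_2_1_def by blast
  have orth': "h b a = 0" "h e a = 0" "h e b = 0"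
    using orth hermitian_form_cnj[OF h] by (metis complex_cnj_zero)+
  have "x = 0" if null: "h x x = 0" and xe: "h x e = 0" for x
  proof -
    have "x \<in> vec.span {a, b, e}"
      unfolding span by simp
    then obtain r s t where "x - r *s a - s *s b - t *s e = 0"
      by (auto simp: vec.span_breakdown_eq)
    then have x: "x = r *s a + s *s b + t *s e"
      by (simp add: algebra_simps)
    have "t = 0"
      using xe unfolding x by (simp add: hermitian_form_left[OF h] orth norm)
    then have "r * cnj r + s * cnj s = 0"
      using null unfolding x
      by (simp add: hermitian_form_left[OF h] hermitian_form_right[OF h] orth orth' norm mult.commute)
    then have "complex_of_real ((cmod r)\<^sup>2 + (cmod s)\<^sup>2) = 0"
      by (simp only: of_real_add complex_norm_square)
    then have "(cmod r)\<^sup>2 + (cmod s)\<^sup>2 = 0"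
      by (simp only: of_real_eq_0_iff)
    then have "r = 0 \<and> s = 0"
      by (simp add: sum_power2_eq_zero_iff)
    then show "x = 0"
      using x \<open>t = 0\<close> by simp
  qed
  then show thesis
    using that by blast
qed

lemma hermitian_form_nondegenerate:
  assumes "hermitian_form h" "signature_2_1 h" "\<And>y. h x y = 0"
  shows "x = 0"
  using null_free_hyperplane[OF assms(1,2)] assms(3) by metis

text \<open>
  A totally isotropic subspace meets a null-free hyperplane trivially, so it has dimension at
  most one: the combination of \<open>x\<close> and \<open>y\<close> that lies in the hyperplane vanishes.
\<close>

lemma null_orthogonal_imp_parallel:
  assumes h: "hermitian_form h" and sig: "signature_2_1 h"
    and null: "h x x = 0" "h y y = 0" and orth: "h x y = 0" and "x \<noteq> 0"
  obtains c where "y = c *s x"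
proof -
  obtain e where e: "\<And>x. h x x = 0 \<Longrightarrow> h x e = 0 \<Longrightarrow> x = 0"
    using null_free_hyperplane[OF h sig] by blast
  have "h x e \<noteq> 0"
    using e null \<open>x \<noteq> 0\<close> by blast
  define z where "z = h y e *s x - h x e *s y"
  have "h y x = 0"
    using orth hermitian_form_cnj[OF h, of y x] by simp
  then have "h z z = 0" "h z e = 0"
    unfolding z_def using null orth
    by (simp_all add: hermitian_form_left[OF h] hermitian_form_right[OF h])
  then have "h x e *s y = h y e *s x"
    using e unfolding z_def by fastforce
  then have "inverse (h x e) *s (h x e *s y) = inverse (h x e) *s (h y e *s x)"
    by simp
  then have "y = (inverse (h x e) * h y e) *s x"
    using \<open>h x e \<noteq> 0\<close> by (simp add: vector_smult_assoc)
  then show thesis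
    using that by blast
qed

lemma distinct_boundary_points_not_orthogonal:
  assumes "hermitian_form h" "signature_2_1 h"
    and "is_lift x p" "h x x = 0" "is_lift y q" "h y y = 0" "p \<noteq> q"
  shows "h x y \<noteq> 0"
proof
  assume "h x y = 0"
  then obtain c where c: "y = c *s x"
    using null_orthogonal_imp_parallel assms unfolding is_lift_def by metis
  have "c \<noteq> 0"
    using c assms(5) by (auto simp: is_lift_def)
  then have "vec.span {y} = vec.span {x}"
    using vec.span_image_scale[of "{x}" "\<lambda>_. c"] c by simp
  then show False
    using assms unfolding is_lift_def by blast
qed

section \<open>Matrices preserving the form and their fixed points\<close>

lemma U21_preserves:
  assumes "M \<in> U21 h"
  shows "h (M *v x) (M *v y) = h x y"
  using assms unfolding U21_def by blast

lemma U21_mult: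
  assumes "M \<in> U21 h" "N \<in> U21 h"
  shows "M ** N \<in> U21 h"
  using assms unfolding U21_def by (simp flip: matrix_vector_mul_assoc)

lemma U21_kernel:
  assumes "hermitian_form h" "signature_2_1 h" "M \<in> U21 h" "M *v x = 0"
  shows "x = 0"
proof (rule hermitian_form_nondegenerate[OF assms(1,2)])
  show "h x y = 0" for y
    using U21_preserves[OF assms(3), of x y] assms(4) hermitian_form_left(4)[OF assms(1)] by simp
qed

lemma U21_invertible:
  assumes "hermitian_form h" "signature_2_1 h" "M \<in> U21 h"
  shows "invertible M"
  using U21_kernel[OF assms] by (simp add: invertible_left_inverse matrix_left_invertible_ker)

lemma matrix_image_span:
  fixes M :: "complex^3^3"
  shows "(*v) M ` vec.span {v} = vec.span {M *v v}"
  by (simp add: vec.span_singleton image_image vector_scalar_commute)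

lemma is_lift_image:
  assumes "hermitian_form h" "signature_2_1 h" "M \<in> U21 h" "is_lift v p"
  shows "is_lift (M *v v) ((*v) M ` p)"
  using assms(4) U21_kernel[OF assms(1-3), of v] by (auto simp: is_lift_def matrix_image_span)

lemma image_closed_H2:
  assumes "hermitian_form h" "signature_2_1 h" "M \<in> U21 h" "p \<in> closed_H2 h"
  shows "(*v) M ` p \<in> closed_H2 h"
proof -
  obtain v where v: "is_lift v p" "Re (h v v) < 0 \<or> h v v = 0"
    using assms(4) unfolding closed_H2_def H2_def bd_H2_def by blast
  have "is_lift (M *v v) ((*v) M ` p)"
    using is_lift_image[OF assms(1-3) v(1)] .
  moreover have "Re (h (M *v v) (M *v v)) < 0 \<or> h (M *v v) (M *v v) = 0"
    using v(2) by (simp only: U21_preserves[OF assms(3)])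
  ultimately show ?thesis
    unfolding closed_H2_def H2_def bd_H2_def by blast
qed

lemma proj_map_compose:
  assumes "hermitian_form h" "signature_2_1 h" "N \<in> U21 h"
  shows "compose (closed_H2 h) (proj_map h M) (proj_map h N) = proj_map h (M ** N)"
proof
  show "compose (closed_H2 h) (proj_map h M) (proj_map h N) p = proj_map h (M ** N) p" for p
    using image_closed_H2[OF assms, of p]
    by (auto simp: compose_def proj_map_def image_image matrix_vector_mul_assoc)
qed

lemma bd_H2_subset_closed: "bd_H2 h \<subseteq> closed_H2 h"
  by (simp add: closed_H2_def)

lemma image_eq_lift:
  assumes "is_lift v p" "is_lift w q" "(*v) M ` p = q"
  obtains l where "M *v v = l *s w"
proof -
  have "v \<in> p"
    using assms(1) vec.span_base[of v "{v}"] by (simp add: is_lift_def)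
  then have "M *v v \<in> vec.span {w}"
    using assms(2,3) by (auto simp: is_lift_def)
  then show thesis
    using that by (auto simp: vec.span_singleton)
qed

lemma eigenvector_fixes_line:
  assumes "hermitian_form h" "signature_2_1 h" "M \<in> U21 h" "is_lift v p" "M *v v = l *s v"
  shows "(*v) M ` p = p"
proof -
  have "l \<noteq> 0"
    using U21_kernel[OF assms(1-3), of v] assms(4,5) by (auto simp: is_lift_def)
  then have "vec.span {l *s v} = vec.span {v}"
    using vec.span_image_scale[of "{v}" "\<lambda>_. l"] by simp
  then show ?thesis
    using assms(4,5) by (simp add: is_lift_def matrix_image_span)
qed

lemma parabolic_fixed_point_unique:
  assumes "parabolic h T" "p \<in> closed_H2 h" "T p = p" "q \<in> closed_H2 h" "T q = q"
  shows "p = q"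
proof -
  obtain r where "{p \<in> closed_H2 h. T p = p} = {r}"
    using assms(1) unfolding parabolic_def by blast
  then have "p \<in> {r}" "q \<in> {r}"
    using assms(2-5) by blast+
  then show ?thesis
    by simp
qed

text \<open>
  The spectrum of a matrix preserving the form is symmetric in the unit circle. Every vector
  \<open>M x - l x\<close> with \<open>l = 1 / cnj \<alpha>\<close> is orthogonal to the \<open>\<alpha>\<close>-eigenvector, so \<open>M - l\<close> is not
  surjective, hence not injective.
\<close>

lemma reflected_eigenvalue:
  assumes h: "hermitian_form h" and sig: "signature_2_1 h" and M: "M \<in> U21 h"
    and eig: "M *v v = \<alpha> *s v" and "v \<noteq> 0"
  obtains w where "w \<noteq> 0" "M *v w = (1 / cnj \<alpha>) *s w"
proof -
  define l where "l = 1 / cnj \<alpha>"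
  have "\<alpha> \<noteq> 0"
    using U21_kernel[OF h sig M, of v] eig \<open>v \<noteq> 0\<close> by auto
  let ?f = "\<lambda>x. M *v x - l *s x"
  have lin: "Vector_Spaces.linear (*s) (*s) ?f"
    by (intro vec.linear_compose_sub matrix_vector_mul_linear_gen vec.linear_scale_self)
  have orth: "h (?f x) v = 0" for x
  proof -
    have "cnj \<alpha> * h (M *v x) v = h x v"
      using U21_preserves[OF M, of x v] unfolding eig hermitian_form_right[OF h] .
    then have "h (M *v x) v = l * h x v"
      using \<open>\<alpha> \<noteq> 0\<close> unfolding l_def by (simp add: field_simps)
    then show ?thesis
      by (simp add: hermitian_form_left[OF h])
  qed
  have "\<not> surj ?f"
  proof
    assume "surj ?f"
    have "h v y = 0" for y
    proof -
      obtain x where "y = ?f x"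
        using \<open>surj ?f\<close> by (rule surjE)
      then have "h y v = 0"
        by (simp only: orth)
      then show ?thesis
        by (simp add: hermitian_form_cnj[OF h, of v y])
    qed
    then show False
      using hermitian_form_nondegenerate[OF h sig, of v] \<open>v \<noteq> 0\<close> by blast
  qed
  then have "\<not> inj ?f"
    using vec.linear_inj_imp_surj[OF lin] by blast
  then obtain w where "w \<noteq> 0" "?f w = 0"
    using vec.linear_inj_iff_eq_0[OF lin] by blast
  then show thesis
    using that unfolding l_def by simp
qed

text \<open>
  An eigenvector whose eigenvalue is off the unit circle is null, because the form is preserved.
  If \<open>cmod \<alpha> \<noteq> 1\<close>, then \<open>1 / cnj \<alpha>\<close> is a different eigenvalue off the unit circle, and its
  eigenvector spans a second fixed boundary point.
\<close>

lemma parabolic_eigenvalue_unimodular: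
  assumes h: "hermitian_form h" and sig: "signature_2_1 h" and M: "M \<in> U21 h"
    and par: "parabolic h (proj_map h M)"
    and v: "is_lift v p" "h v v = 0" and eig: "M *v v = \<alpha> *s v"
  shows "cmod \<alpha> = 1"
proof (rule ccontr)
  assume ne: "cmod \<alpha> \<noteq> 1"
  have "v \<noteq> 0" and p: "p = vec.span {v}"
    using v(1) by (auto simp: is_lift_def)
  define l where "l = 1 / cnj \<alpha>"
  obtain w where w: "w \<noteq> 0" "M *v w = l *s w"
    using reflected_eigenvalue[OF h sig M eig \<open>v \<noteq> 0\<close>] unfolding l_def by blast
  have "\<alpha> \<noteq> 0"
    using U21_kernel[OF h sig M, of v] eig \<open>v \<noteq> 0\<close> by auto
  have l1: "cmod l \<noteq> 1"
    using ne \<open>\<alpha> \<noteq> 0\<close> by (simp add: l_def norm_divide)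
  have "h w w = l * cnj l * h w w"
    using U21_preserves[OF M, of w w]
    by (simp add: w hermitian_form_left[OF h] hermitian_form_right[OF h] mult_ac)
  moreover have off_circle: "l * cnj l \<noteq> 1"
  proof
    assume "l * cnj l = 1"
    then have "complex_of_real ((cmod l)\<^sup>2) = of_real 1"
      by (simp only: complex_norm_square of_real_1)
    then have "(cmod l)\<^sup>2 = 1"
      by (simp only: of_real_eq_iff)
    then show False
      using l1 norm_ge_zero[of l] by (auto simp: power2_eq_1_iff simp del: norm_ge_zero)
  qed
  ultimately have "h w w = 0"
    by simp
  have fixed: "vec.span {u} \<in> closed_H2 h" "proj_map h M (vec.span {u}) = vec.span {u}"
    if "u \<noteq> 0" "h u u = 0" "M *v u = k *s u" for u k
  proof -
    have u: "is_lift u (vec.span {u})"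
      using \<open>u \<noteq> 0\<close> by (simp add: is_lift_def)
    then show "vec.span {u} \<in> closed_H2 h"
      using \<open>h u u = 0\<close> unfolding closed_H2_def bd_H2_def by blast
    then show "proj_map h M (vec.span {u}) = vec.span {u}"
      using eigenvector_fixes_line[OF h sig M u that(3)] by (simp add: proj_map_def)
  qed
  have "vec.span {w} = vec.span {v}"
    using parabolic_fixed_point_unique[OF par] fixed[OF \<open>v \<noteq> 0\<close> v(2) eig]
      fixed[OF w(1) \<open>h w w = 0\<close> w(2)] by blast
  then have "w \<in> vec.span {v}"
    using vec.span_base[of w "{w}"] by simp
  then obtain c where c: "w = c *s v"
    by (auto simp: vec.span_singleton)
  have "(l - \<alpha>) *s w = 0"
  proof -
    have "l *s w = M *v w"
      by (simp only: w(2))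
    also have "\<dots> = c *s (\<alpha> *s v)"
      by (simp only: c vector_scalar_commute eig)
    also have "\<dots> = \<alpha> *s w"
      by (simp add: c vector_smult_assoc mult.commute)
    finally show ?thesis
      by (simp add: vector_sub_rdistrib)
  qed
  then have "l = \<alpha>"
    using \<open>w \<noteq> 0\<close> by (simp only: vector_mul_eq_0 right_minus_eq simp_thms)
  then have "\<alpha> * cnj \<alpha> = 1"
    using \<open>\<alpha> \<noteq> 0\<close> unfolding l_def by (simp add: field_simps)
  then show False
    using off_circle \<open>l = \<alpha>\<close> by simp
qed

section \<open>The cross-ratio of the fixed points\<close>

text \<open>
  \<open>h d a\<close> and \<open>h c a\<close> are related by \<open>M\<close>, which moves \<open>d\<close> to the line of \<open>c\<close>; \<open>h c b\<close> and
  \<open>h d b\<close> are related by \<open>N\<close>, which moves \<open>c\<close> back. The scalars for the two moves multiply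
  to the eigenvalue \<open>k * m\<close> of \<open>M N\<close> at \<open>c\<close>.
\<close>

lemma cross_ratio_of_swapped_points:
  assumes h: "hermitian_form h" and M: "M \<in> U21 h" and N: "N \<in> U21 h"
    and a: "M *v a = \<alpha> *s a" and b: "N *v b = \<beta> *s b"
    and d: "M *v d = k *s c" and c: "N *v c = m *s d"
    and ne: "h c a \<noteq> 0" "h d b \<noteq> 0" "h c b \<noteq> 0" "h d a \<noteq> 0"
  shows "(h c a * h d b) / (h c b * h d a) = 1 / (cnj \<alpha> * cnj \<beta> * (k * m))"
proof -
  have da: "h d a = k * cnj \<alpha> * h c a"
    using U21_preserves[OF M, of d a]
    by (simp add: a d hermitian_form_left[OF h] hermitian_form_right[OF h] mult_ac)
  have cb: "h c b = m * cnj \<beta> * h d b"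
    using U21_preserves[OF N, of c b]
    by (simp add: b c hermitian_form_left[OF h] hermitian_form_right[OF h] mult_ac)
  show ?thesis
    using ne unfolding da cb by (simp add: field_simps)
qed

text \<open>
  Elements of PU(2,1) come with lifts to the unitary group, and the quotient \<open>\<alpha> * \<beta> / \<mu>\<close> is the
  same for all of them: rescaling \<open>M\<close> and \<open>N\<close> changes \<open>\<alpha> * \<beta>\<close> and \<open>\<mu>\<close> by the same factor. One
  formula thus yields both the modulus and, for lifts of determinant one, the eigenvalue product.
\<close>

lemma cross_ratio_parabolic_pair:
  assumes h: "hermitian_form h" and sig: "signature_2_1 h"
    and M: "M \<in> U21 h" and N: "N \<in> U21 h"
    and par: "parabolic h (proj_map h M)" "parabolic h (proj_map h N)"
      "parabolic h (proj_map h (M ** N))"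
    and pA: "pA \<in> bd_H2 h" "proj_map h M pA = pA"
    and pB: "pB \<in> bd_H2 h" "proj_map h N pB = pB"
    and pAB: "pAB \<in> bd_H2 h" "proj_map h (M ** N) pAB = pAB"
    and pBA: "pBA \<in> bd_H2 h" "proj_map h (N ** M) pBA = pBA"
    and dist: "distinct [pA, pB, pAB, pBA]"
  obtains a b c \<alpha> \<beta> \<mu> where
    "is_lift a pA" "M *v a = \<alpha> *s a" "cmod \<alpha> = 1"
    "is_lift b pB" "N *v b = \<beta> *s b" "cmod \<beta> = 1"
    "is_lift c pAB" "(M ** N) *v c = \<mu> *s c" "cmod \<mu> = 1"
    "cross_ratio h pA pB pAB pBA = \<alpha> * \<beta> / \<mu>"
proof -
  have MN: "M ** N \<in> U21 h"
    using U21_mult[OF M N] .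
  have closed: "p \<in> closed_H2 h" if "p \<in> bd_H2 h" for p
    using that bd_H2_subset_closed by blast
  have img: "(*v) M ` pA = pA" "(*v) N ` pB = pB" "(*v) (M ** N) ` pAB = pAB"
    "(*v) (N ** M) ` pBA = pBA"
    using pA pB pAB pBA closed by (simp_all add: proj_map_def)
  obtain a b c d where a: "is_lift a pA" "h a a = 0" and b: "is_lift b pB" "h b b = 0"
    and c: "is_lift c pAB" "h c c = 0" and d: "is_lift d pBA" "h d d = 0"
    using pA(1) pB(1) pAB(1) pBA(1) unfolding bd_H2_def by blast
  obtain \<alpha> where \<alpha>: "M *v a = \<alpha> *s a"
    using image_eq_lift[OF a(1) a(1) img(1)] by blast
  obtain \<beta> where \<beta>: "N *v b = \<beta> *s b"
    using image_eq_lift[OF b(1) b(1) img(2)] by blast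
  obtain \<mu> where \<mu>: "(M ** N) *v c = \<mu> *s c"
    using image_eq_lift[OF c(1) c(1) img(3)] by blast
  have unit: "cmod \<alpha> = 1" "cmod \<beta> = 1" "cmod \<mu> = 1"
    using parabolic_eigenvalue_unimodular[OF h sig M par(1) a \<alpha>]
      parabolic_eigenvalue_unimodular[OF h sig N par(2) b \<beta>]
      parabolic_eigenvalue_unimodular[OF h sig MN par(3) c \<mu>] .
  \<comment> \<open>\<open>M N\<close> fixes the image of \<open>pBA\<close> under \<open>M\<close>, and it fixes only one point.\<close>
  have "(*v) (M ** N) ` (*v) M ` pBA = (*v) M ` (*v) (N ** M) ` pBA"
    by (simp add: image_image matrix_vector_mul_assoc matrix_mul_assoc)
  then have "proj_map h (M ** N) ((*v) M ` pBA) = (*v) M ` pBA"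
    using image_closed_H2[OF h sig M closed[OF pBA(1)]] img(4) by (simp add: proj_map_def)
  then have "(*v) M ` pBA = pAB"
    using parabolic_fixed_point_unique[OF par(3)] image_closed_H2[OF h sig M closed[OF pBA(1)]]
      closed[OF pAB(1)] pAB(2) by blast
  then obtain k where k: "M *v d = k *s c"
    using image_eq_lift[OF d(1) c(1)] by blast
  have "k \<noteq> 0"
    using U21_kernel[OF h sig M, of d] k d(1) by (auto simp: is_lift_def)
  have "M *v (N *v c - (\<mu> / k) *s d) = 0"
    using \<mu> \<open>k \<noteq> 0\<close>
    by (simp add: matrix_vector_mult_diff_distrib vector_scalar_commute k
        vector_smult_assoc matrix_vector_mul_assoc)
  then have Nc: "N *v c = (\<mu> / k) *s d"
    using U21_kernel[OF h sig M, of "N *v c - (\<mu> / k) *s d"] by simp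
  have ne: "h c a \<noteq> 0" "h d b \<noteq> 0" "h c b \<noteq> 0" "h d a \<noteq> 0"
    using dist distinct_boundary_points_not_orthogonal[OF h sig c a]
      distinct_boundary_points_not_orthogonal[OF h sig d b]
      distinct_boundary_points_not_orthogonal[OF h sig c b]
      distinct_boundary_points_not_orthogonal[OF h sig d a] by auto
  have "cross_ratio h pA pB pAB pBA = (h c a * h d b) / (h c b * h d a)"
    using cross_ratio_eq[OF h a(1) b(1) c(1) d(1)] .
  also have "\<dots> = 1 / (cnj \<alpha> * cnj \<beta> * (k * (\<mu> / k)))"
    using cross_ratio_of_swapped_points[OF h M N \<alpha> \<beta> k Nc ne] .
  also have "\<dots> = \<alpha> * \<beta> / \<mu>"
  proof -
    have "\<alpha> * cnj \<alpha> = 1" "\<beta> * cnj \<beta> = 1"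
      using unit by (simp_all flip: complex_norm_square)
    then have "(\<alpha> * \<beta>) * (cnj \<alpha> * cnj \<beta>) = 1"
      by (simp add: mult_ac)
    moreover from this have "cnj \<alpha> * cnj \<beta> \<noteq> 0"
      by auto
    ultimately have "1 / (cnj \<alpha> * cnj \<beta>) = \<alpha> * \<beta>"
      by (simp add: divide_eq_eq)
    then show ?thesis
      using \<open>k \<noteq> 0\<close> by (simp flip: divide_divide_eq_left)
  qed
  finally show thesis
    using that a(1) \<alpha> b(1) \<beta> c(1) \<mu> unit by blast
qed

theorem corollary2p6:
  fixes h :: "complex^3 \<Rightarrow> complex^3 \<Rightarrow> complex"
    and A B :: "cline \<Rightarrow> cline"
    and pA pB pAB pBA :: cline
  assumes "hermitian_form h" and "signature_2_1 h"
    and "A \<in> PU21 h" and "B \<in> PU21 h"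
    and "parabolic h A" and "parabolic h B"
    and "parabolic h (compose (closed_H2 h) A B)"
    and "pA \<in> bd_H2 h" and "A pA = pA"
    and "pB \<in> bd_H2 h" and "B pB = pB"
    and "pAB \<in> bd_H2 h" and "compose (closed_H2 h) A B pAB = pAB"
    and "pBA \<in> bd_H2 h" and "compose (closed_H2 h) B A pBA = pBA"
    and "distinct [pA, pB, pAB, pBA]"
  shows "cmod (cross_ratio h pA pB pAB pBA) = 1 \<and>
    (\<forall>MA MB MC. is_SU_lift h MA A \<longrightarrow> is_SU_lift h MB B \<longrightarrow> MC = matrix_inv (MA ** MB) \<longrightarrow>
       cross_ratio h pA pB pAB pBA =
         eigenvalue_at MA pA * eigenvalue_at MB pB * eigenvalue_at MC pAB)"
proof (intro conjI allI impI)
  note h = assms(1) and sig = assms(2)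
  have key: "\<exists>a b c \<alpha> \<beta> \<mu>. is_lift a pA \<and> M *v a = \<alpha> *s a \<and> cmod \<alpha> = 1 \<and>
      is_lift b pB \<and> N *v b = \<beta> *s b \<and> cmod \<beta> = 1 \<and>
      is_lift c pAB \<and> (M ** N) *v c = \<mu> *s c \<and> cmod \<mu> = 1 \<and>
      cross_ratio h pA pB pAB pBA = \<alpha> * \<beta> / \<mu>"
    if M: "M \<in> U21 h" and N: "N \<in> U21 h" and A: "A = proj_map h M" and B: "B = proj_map h N"
    for M N
  proof -
    have comp: "compose (closed_H2 h) A B = proj_map h (M ** N)"
      "compose (closed_H2 h) B A = proj_map h (N ** M)"
      unfolding A B using proj_map_compose[OF h sig N] proj_map_compose[OF h sig M] .
    show ?thesis
      by (rule cross_ratio_parabolic_pair[OF h sig M N assms(5-16)[unfolded comp, unfolded A B]])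
        blast
  qed
  show "cmod (cross_ratio h pA pB pAB pBA) = 1"
  proof -
    obtain M N where "M \<in> U21 h" "N \<in> U21 h" "A = proj_map h M" "B = proj_map h N"
      using assms(3,4) unfolding PU21_def by blast
    from key[OF this] show ?thesis
      by (auto simp: norm_mult norm_divide)
  qed
  fix MA MB MC
  assume MA: "is_SU_lift h MA A" and MB: "is_SU_lift h MB B" and MC: "MC = matrix_inv (MA ** MB)"
  have U: "MA \<in> U21 h" "MB \<in> U21 h" and eq: "A = proj_map h MA" "B = proj_map h MB"
    using MA MB unfolding is_SU_lift_def SU21_def by auto
  obtain a b c \<alpha> \<beta> \<mu> where a: "is_lift a pA" "MA *v a = \<alpha> *s a"
    and b: "is_lift b pB" "MB *v b = \<beta> *s b"
    and c: "is_lift c pAB" "(MA ** MB) *v c = \<mu> *s c" and "cmod \<mu> = 1"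
    and X: "cross_ratio h pA pB pAB pBA = \<alpha> * \<beta> / \<mu>"
    using key[OF U eq] by blast
  have "\<mu> \<noteq> 0"
    using \<open>cmod \<mu> = 1\<close> by auto
  have "MC ** (MA ** MB) = mat 1"
    using U21_invertible[OF h sig U21_mult[OF U]]
    unfolding MC matrix_inv_def invertible_def by (rule someI2_ex) blast
  then have "c = MC *v (\<mu> *s c)"
    using c(2) by (metis matrix_vector_mul_assoc matrix_vector_mul_lid)
  then have "c = \<mu> *s (MC *v c)"
    by (simp add: vector_scalar_commute)
  then have "(1 / \<mu>) *s c = (1 / \<mu>) *s (\<mu> *s (MC *v c))"
    by simp
  then have "MC *v c = (1 / \<mu>) *s c"
    using \<open>\<mu> \<noteq> 0\<close> by (simp add: vector_smult_assoc)
  then have "eigenvalue_at MC pAB = 1 / \<mu>"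
    by (rule eigenvalue_at_eq[OF c(1)])
  then show "cross_ratio h pA pB pAB pBA =
      eigenvalue_at MA pA * eigenvalue_at MB pB * eigenvalue_at MC pAB"
    using eigenvalue_at_eq[OF a] eigenvalue_at_eq[OF b] X by simp
qed

end
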